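(* Let $\{(\tilde z_k,z_k,r_k,\varepsilon_k,\lambda_k,\eta_k)\}$ be generated by the NE-HPE framework with $\sigma<1$. Then, for every $k\ge1$, $r_k\in T^{[\varepsilon_k]}(\tilde z_k)$ and the following statements hold: (a) if $\underline\lambda:=\inf_{j\ge1}\lambda_j>0$, then there exists $i\le k$ such that $$\|r_i\|^*\le\frac{2M}{\sqrt m}\sqrt{\frac{(1+\sigma)(dw)_0+2\eta_0}{1-\sigma}\left(\frac{\lambda_i^{-1}}{\sum_{j=1}^k\lambda_j}\right)}\le\frac{2M}{\underline\lambda\sqrt{mk}}\sqrt{\frac{(1+\sigma)(dw)_0+2\eta_0}{1-\sigma}},$$ $$\varepsilon_i\le\frac{(1+\sigma)(dw)_0+2\eta_0}{(1-\sigma)\sum_{j=1}^k\lambda_j}\le\frac{(1+\sigma)(dw)_0+2\eta_0}{(1-\sigma)\underline\lambda k};$$ (b) there exists an index $i\le k$ such that $$\|r_i\|^*\le\frac{2M}{\sqrt m}\sqrt{\frac{(1+\sigma)(dw)_0+2\eta_0}{1-\sigma}\left(\frac{1}{\sum_{j=1}^k\lambda_j^2}\right)},\qquad \varepsilon_i\le\frac{[(1+\sigma)(dw)_0+2\eta_0]\lambda_i}{(1-\sigma)\sum_{j=1}^k\lambda_j^2}.$$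
   Context: $\mathcal Z$ is a finite-dimensional real inner product space. A proper lower semicontinuous convex $w:\mathcal Z\to(-\infty,\infty]$ is a distance generating function if $\mathrm{int}(\mathrm{dom}\,w)=\mathrm{Dom}\,\partial w\ne\emptyset$ and $w$ is continuously differentiable on this interior; its Bregman distance is $(dw)_z(z')=w(z')-w(z)-\langle\nabla w(z),z'-z\rangle$ for $z'\in\mathcal Z$, $z\in\mathrm{int}(\mathrm{dom}\,w)$, and $\nabla(dw)_z(z')=\nabla w(z')-\nabla w(z)$. For a seminorm $\|\cdot\|$ on $\mathcal Z$, the dual extended seminorm is $\|u\|^*=\sup\{\langle u,v\rangle:\|v\|\le1\}\in[0,\infty]$. For a convex set $Z\subset\mathrm{int}(\mathrm{dom}\,w)$ and $m,M>0$, $w$ is $(m,M)$-regular with respect to $(Z,\|\cdot\|)$ if for all $z,z'\in Z$: $(dw)_z(z')\ge\frac m2\|z-z'\|^2$ and $\|\nabla w(z)-\nabla w(z')\|^*\le M\|z-z'\|$. Standing assumptions: $Z\subset\mathrm{int}(\mathrm{dom}\,w)$ is a closed convex set, $\|\cdot\|$ is a seminorm on $\mathcal Z$, $w$ is an $(m,M)$-regular distance generating function with respect to $(Z,\|\cdot\|)$; $T:\mathcal Z\rightrightarrows\mathcal Z$ is maximal monotone with $\mathrm{Dom}\,T\subset Z$ and $T^{-1}(0)\ne\emptyset$. For $\varepsilon\ge0$, $T^{[\varepsilon]}(v)=\{v':\langle v'-v_2,v-v_1\rangle\ge-\varepsilon\ \ \forall v_1,\ \forall v_2\in T(v_1)\}$.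 NE-HPE framework: given $z_0\in Z$, $\eta_0\ge0$, $\sigma\in[0,1]$, at every iteration $k=1,2,\dots$ one chooses $\lambda_k>0$ and $(\tilde z_k,z_k,\varepsilon_k,\eta_k)\in Z\times Z\times\mathbb R_+\times\mathbb R_+$ such that $$r_k:=\frac1{\lambda_k}\nabla(dw)_{z_k}(z_{k-1})\in T^{[\varepsilon_k]}(\tilde z_k),\qquad (dw)_{z_k}(\tilde z_k)+\lambda_k\varepsilon_k+\eta_k\le\sigma(dw)_{z_{k-1}}(\tilde z_k)+\eta_{k-1}.$$ Also $(dw)_0:=\inf\{(dw)_{z_0}(z^* ):z^*\in T^{-1}(0)\}$. Indices $i$ are in $\{1,\dots,k\}$. *)

theory Defs
  imports "HOL-Analysis.Analysis"
begin

definition effective_domain :: "('a \<Rightarrow> ereal) \<Rightarrow> 'a set" where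
  "effective_domain f = {x. f x < \<infinity>}"

definition proper_fun :: "('a \<Rightarrow> ereal) \<Rightarrow> bool" where
  "proper_fun f \<longleftrightarrow> (\<forall>x. f x \<noteq> -\<infinity>) \<and> effective_domain f \<noteq> {}"

definition lower_semicontinuous :: "('a::topological_space \<Rightarrow> ereal) \<Rightarrow> bool" where
  "lower_semicontinuous f \<longleftrightarrow> (\<forall>x. f x \<le> Liminf (at x) f)"

definition convex_fun :: "('a::real_vector \<Rightarrow> ereal) \<Rightarrow> bool" where
  "convex_fun f \<longleftrightarrow> convex {(x, t::real). f x \<le> ereal t}"

(* For proper f the set is empty wherever f is infinite. *)
definition subdifferential :: "('a::real_inner \<Rightarrow> ereal) \<Rightarrow> 'a \<Rightarrow> 'a set" where
  "subdifferential f z = {v. \<forall>z'. f z' \<ge> f z + ereal (v \<bullet> (z' - z))}"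

(* real_of_ereal sends infinite values to 0, so this is the intended notion only at interior
   points of the effective domain. *)
definition has_grad :: "('a::real_inner \<Rightarrow> ereal) \<Rightarrow> 'a \<Rightarrow> 'a \<Rightarrow> bool" where
  "has_grad f z D \<longleftrightarrow> GDERIV (\<lambda>x. real_of_ereal (f x)) z :> D"

definition grad :: "('a::real_inner \<Rightarrow> ereal) \<Rightarrow> 'a \<Rightarrow> 'a" where
  "grad f z = (THE D. has_grad f z D)"

definition op_Dom :: "('a \<Rightarrow> 'b set) \<Rightarrow> 'a set" where
  "op_Dom T = {x. T x \<noteq> {}}"

definition op_inverse :: "('a \<Rightarrow> 'b set) \<Rightarrow> 'b \<Rightarrow> 'a set" where
  "op_inverse T u = {x. u \<in> T x}"

definition monotone_op :: "('a::real_inner \<Rightarrow> 'a set) \<Rightarrow> bool" where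
  "monotone_op T \<longleftrightarrow> (\<forall>x y. \<forall>u\<in>T x. \<forall>v\<in>T y. (u - v) \<bullet> (x - y) \<ge> 0)"

definition maximal_monotone :: "('a::real_inner \<Rightarrow> 'a set) \<Rightarrow> bool" where
  "maximal_monotone T \<longleftrightarrow>
     monotone_op T \<and> (\<forall>S. monotone_op S \<and> (\<forall>x. T x \<subseteq> S x) \<longrightarrow> S = T)"

definition enlargement :: "('a::real_inner \<Rightarrow> 'a set) \<Rightarrow> real \<Rightarrow> 'a \<Rightarrow> 'a set" where
  "enlargement T \<epsilon> v = {v'. \<forall>v1. \<forall>v2\<in>T v1. (v' - v2) \<bullet> (v - v1) \<ge> - \<epsilon>}"

definition seminorm :: "('a::real_vector \<Rightarrow> real) \<Rightarrow> bool" where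
  "seminorm N \<longleftrightarrow> (\<forall>x. N x \<ge> 0) \<and> (\<forall>x y. N (x + y) \<le> N x + N y) \<and>
     (\<forall>c x. N (c *\<^sub>R x) = \<bar>c\<bar> * N x)"

definition dual_seminorm :: "('a::real_inner \<Rightarrow> real) \<Rightarrow> 'a \<Rightarrow> ereal" where
  "dual_seminorm N u = (SUP v\<in>{v. N v \<le> 1}. ereal (u \<bullet> v))"

definition distance_generating :: "('a::real_inner \<Rightarrow> ereal) \<Rightarrow> bool" where
  "distance_generating w \<longleftrightarrow>
     proper_fun w \<and> lower_semicontinuous w \<and> convex_fun w \<and>
     interior (effective_domain w) = op_Dom (subdifferential w) \<and>
     op_Dom (subdifferential w) \<noteq> {} \<and>
     (\<forall>z\<in>interior (effective_domain w). \<exists>D. has_grad w z D) \<and>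
     continuous_on (interior (effective_domain w)) (grad w)"

(* The base point is the second argument: bregman w z z' is (dw)_z(z'). *)
definition bregman :: "('a::real_inner \<Rightarrow> ereal) \<Rightarrow> 'a \<Rightarrow> 'a \<Rightarrow> ereal" where
  "bregman w z z' = w z' - w z - ereal (grad w z \<bullet> (z' - z))"

definition regular_wrt ::
    "('a::real_inner \<Rightarrow> ereal) \<Rightarrow> real \<Rightarrow> real \<Rightarrow> 'a set \<Rightarrow> ('a \<Rightarrow> real) \<Rightarrow> bool" where
  "regular_wrt w m M Z N \<longleftrightarrow>
     convex Z \<and> Z \<subseteq> interior (effective_domain w) \<and> m > 0 \<and> M > 0 \<and>
     (\<forall>z\<in>Z. \<forall>z'\<in>Z. bregman w z z' \<ge> ereal (m / 2 * (N (z - z'))\<^sup>2) \<and>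
        dual_seminorm N (grad w z - grad w z') \<le> ereal (M * N (z - z')))"

definition bregman_dist0 :: "('a::real_inner \<Rightarrow> ereal) \<Rightarrow> 'a \<Rightarrow> ('a \<Rightarrow> 'a set) \<Rightarrow> ereal" where
  "bregman_dist0 w z0 T = (INF zs\<in>op_inverse T 0. bregman w z0 zs)"

(* The value at index 0 is meaningful only for z and \<eta>; zt stands for the tilde sequence. *)
definition NE_HPE ::
    "('a::real_inner \<Rightarrow> ereal) \<Rightarrow> 'a set \<Rightarrow> ('a \<Rightarrow> 'a set) \<Rightarrow> real \<Rightarrow>
     (nat \<Rightarrow> 'a) \<Rightarrow> (nat \<Rightarrow> 'a) \<Rightarrow> (nat \<Rightarrow> 'a) \<Rightarrow> (nat \<Rightarrow> real) \<Rightarrow> (nat \<Rightarrow> real) \<Rightarrow> (nat \<Rightarrow> real) \<Rightarrow> bool" where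
  "NE_HPE w Z T \<sigma> zt z r \<epsilon> lam \<eta> \<longleftrightarrow>
     z 0 \<in> Z \<and> \<eta> 0 \<ge> 0 \<and> 0 \<le> \<sigma> \<and> \<sigma> \<le> 1 \<and>
     (\<forall>k\<ge>1. lam k > 0 \<and> zt k \<in> Z \<and> z k \<in> Z \<and> \<epsilon> k \<ge> 0 \<and> \<eta> k \<ge> 0 \<and>
        r k = (1 / lam k) *\<^sub>R grad (bregman w (z k)) (z (k - 1)) \<and>
        r k \<in> enlargement T (\<epsilon> k) (zt k) \<and>
        bregman w (z k) (zt k) + ereal (lam k * \<epsilon> k + \<eta> k)
          \<le> ereal \<sigma> * bregman w (z (k - 1)) (zt k) + ereal (\<eta> (k - 1)))"

lemma grad_eqI:
  assumes "has_grad f z D"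
  shows "grad f z = D"
  unfolding grad_def
proof (rule the_equality)
  show "has_grad f z D" by (rule assms)
next
  fix E assume "has_grad f z E"
  with assms have "(\<lambda>h. h \<bullet> E) = (\<lambda>h. h \<bullet> D)"
    unfolding has_grad_def gderiv_def by (blast intro: has_derivative_unique)
  then have "\<forall>h. h \<bullet> E = h \<bullet> D"
    by (rule fun_cong[THEN allI])
  then show "E = D"
    by (simp only: vector_eq_ldot)
qed

lemma proper_fun_finite:
  assumes "proper_fun w" and "x \<in> effective_domain w"
  shows "\<bar>w x\<bar> \<noteq> \<infinity>"
  using assms by (auto simp: proper_fun_def effective_domain_def)

lemma bregman_finite:
  assumes "proper_fun w" "z \<in> effective_domain w" "z' \<in> effective_domain w"
  shows "\<bar>bregman w z z'\<bar> \<noteq> \<infinity>"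
  using proper_fun_finite[OF assms(1,2)] proper_fun_finite[OF assms(1,3)]
  by (auto simp: bregman_def)

lemma grad_bregman:
  assumes w: "distance_generating w"
    and z: "z \<in> interior (effective_domain w)" and z': "z' \<in> interior (effective_domain w)"
  shows "grad (bregman w z) z' = grad w z' - grad w z"
proof (rule grad_eqI)
  have pr: "proper_fun w" using w by (simp add: distance_generating_def)
  obtain D where D: "has_grad w z' D"
    using w z' by (auto simp: distance_generating_def)
  have "((\<lambda>x. real_of_ereal (w x) - real_of_ereal (w z) - grad w z \<bullet> (x - z))
      has_derivative (\<lambda>h. h \<bullet> (grad w z' - grad w z))) (at z')"
  proof -
    have w': "((\<lambda>x. real_of_ereal (w x)) has_derivative (\<lambda>h. h \<bullet> grad w z')) (at z')"
      using D unfolding grad_eqI[OF D] has_grad_def gderiv_def .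
    show ?thesis
      by (rule derivative_eq_intros w' refl)+
        (simp add: fun_eq_iff inner_diff_right inner_commute[of "grad w z"])
  qed
  then have "((\<lambda>x. real_of_ereal (bregman w z x)) has_derivative (\<lambda>h. h \<bullet> (grad w z' - grad w z))) (at z')"
  proof (rule has_derivative_transform_within_open[OF _ open_interior z'])
    fix x assume "x \<in> interior (effective_domain w)"
    then have "\<bar>w x\<bar> \<noteq> \<infinity>" "\<bar>w z\<bar> \<noteq> \<infinity>"
      using z by (auto intro!: proper_fun_finite[OF pr] subsetD[OF interior_subset])
    then show "real_of_ereal (w x) - real_of_ereal (w z) - grad w z \<bullet> (x - z)
        = real_of_ereal (bregman w z x)"
      by (auto simp: bregman_def)
  qed
  then show "has_grad (bregman w z) z' (grad w z' - grad w z)"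
    by (simp add: has_grad_def gderiv_def)
qed

lemma bregman_dist0_finite:
  assumes w: "distance_generating w" and reg: "regular_wrt w m M Z N"
    and T: "op_Dom T \<subseteq> Z" "op_inverse T 0 \<noteq> {}" and z0: "z0 \<in> Z"
  shows "\<bar>bregman_dist0 w z0 T\<bar> \<noteq> \<infinity>" and "bregman_dist0 w z0 T \<ge> 0"
proof -
  have sub: "op_inverse T 0 \<subseteq> Z"
    using T by (auto simp: op_Dom_def op_inverse_def)
  have ZD: "Z \<subseteq> effective_domain w"
    using reg by (auto simp: regular_wrt_def intro: subsetD[OF interior_subset])
  have nn: "bregman w z0 x \<ge> 0" if "x \<in> Z" for x
  proof -
    have "ereal (m / 2 * (N (z0 - x))\<^sup>2) \<ge> 0"
      using reg by (simp add: regular_wrt_def)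
    moreover have "ereal (m / 2 * (N (z0 - x))\<^sup>2) \<le> bregman w z0 x"
      using reg z0 that by (simp add: regular_wrt_def)
    ultimately show ?thesis
      by (rule order_trans)
  qed
  then show ge: "bregman_dist0 w z0 T \<ge> 0"
    unfolding bregman_dist0_def using sub by (blast intro: INF_greatest)
  obtain x where x: "x \<in> op_inverse T 0" using T by blast
  then have "bregman_dist0 w z0 T \<le> bregman w z0 x"
    unfolding bregman_dist0_def by (rule INF_lower)
  moreover have "bregman w z0 x < \<infinity>"
  proof -
    have "proper_fun w" using w by (simp add: distance_generating_def)
    moreover have "z0 \<in> effective_domain w" "x \<in> effective_domain w"
      using x z0 sub ZD by blast+
    ultimately show ?thesis
      using bregman_finite[of w z0 x] by auto
  qed
  ultimately show "\<bar>bregman_dist0 w z0 T\<bar> \<noteq> \<infinity>"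
    using ge by auto
qed

end

theory Submission
  imports Defs
begin

text \<open>Put \<open>S\<^sub>j = (dw)\<^bsub>z\<^sub>j\<^sub>-\<^sub>1\<^esub>(zt\<^sub>j) + (dw)\<^bsub>z\<^sub>j\<^esub>(zt\<^sub>j) + \<lambda>\<^sub>j \<epsilon>\<^sub>j\<close>.
  For a zero \<open>x\<close> of \<open>T\<close>, the decrease of \<open>(dw)\<^bsub>z\<^sub>j\<^esub>(x) + \<eta>\<^sub>j\<close> in step \<open>j\<close> is at least
  \<open>(1 - \<sigma>) (dw)\<^bsub>z\<^sub>j\<^sub>-\<^sub>1\<^esub>(zt\<^sub>j)\<close>; telescoping this together with the error criterion bounds
  the sum of the \<open>S\<^sub>j\<close> by \<open>((1 + \<sigma>) d\<^sub>0 + 2 \<eta>\<^sub>0) / (1 - \<sigma>)\<close>. By regularity both \<open>\<lambda>\<^sub>j \<epsilon>\<^sub>j\<close> and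
  (up to the factor \<open>4 M\<^sup>2 / m\<close>) the square of \<open>\<lambda>\<^sub>j \<parallel>r\<^sub>j\<parallel>\<^sup>*\<close> are at most \<open>S\<^sub>j\<close>. Averaging
  \<open>S\<^sub>j\<close> with weights \<open>\<lambda>\<^sub>j\<close> gives (a), with weights \<open>\<lambda>\<^sub>j\<^sup>2\<close> gives (b).\<close>

section \<open>Averaging and seminorm estimates\<close>

text \<open>Otherwise every \<open>s i\<close> exceeds its share \<open>c i * (C / sum c I)\<close>;
  the shares add up to \<open>C\<close>, so \<open>sum s I\<close> would exceed
  \<open>C\<close>.\<close>

lemma exists_le_weighted_average:
  fixes s c :: "'i \<Rightarrow> real"
  assumes "finite I" "I \<noteq> {}" and c: "\<And>i. i \<in> I \<Longrightarrow> c i > 0" and s: "sum s I \<le> C"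
  shows "\<exists>i\<in>I. s i \<le> c i * (C / sum c I)"
proof (rule ccontr)
  assume "\<not> ?thesis"
  then have "(\<Sum>i\<in>I. c i * (C / sum c I)) < sum s I"
    using assms(1,2) by (intro sum_strict_mono) auto
  also have "(\<Sum>i\<in>I. c i * (C / sum c I)) = C"
    unfolding sum_distrib_right[symmetric] using sum_pos[OF assms(1,2), of c] c by simp
  finally show False
    using s by simp
qed

lemma real_of_bregman:
  assumes "proper_fun w" "a \<in> effective_domain w" "b \<in> effective_domain w"
  shows "real_of_ereal (bregman w a b) =
    real_of_ereal (w b) - real_of_ereal (w a) - grad w a \<bullet> (b - a)"
  using proper_fun_finite[OF assms(1,2)] proper_fun_finite[OF assms(1,3)]
  by (auto simp: bregman_def)

lemma dual_seminorm_scaleR_le: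
  assumes "c > 0" and "dual_seminorm N (c *\<^sub>R u) \<le> ereal B"
  shows "dual_seminorm N u \<le> ereal (B / c)"
  unfolding dual_seminorm_def
proof (rule SUP_least)
  fix v assume "v \<in> {v. N v \<le> 1}"
  then have "ereal ((c *\<^sub>R u) \<bullet> v) \<le> dual_seminorm N (c *\<^sub>R u)"
    unfolding dual_seminorm_def by (rule SUP_upper)
  also note assms(2)
  finally show "ereal (u \<bullet> v) \<le> ereal (B / c)"
    using assms(1) by (simp add: field_simps)
qed

lemma seminorm_minus_commute:
  assumes "seminorm N"
  shows "N (x - y) = N (y - x)"
proof -
  have "N ((-1) *\<^sub>R (y - x)) = \<bar>-1\<bar> * N (y - x)"
    using assms unfolding seminorm_def by blast
  then show ?thesis by simp
qed

text \<open>Triangle inequality through \<open>y\<close>, then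
  \<open>(s + t)\<^sup>2 \<le> 2 * (s\<^sup>2 + t\<^sup>2)\<close>; this 2 times the
  \<open>2 / m\<close> from the hypotheses gives \<open>4 / m\<close>.\<close>

lemma seminorm_dist_sq_le:
  assumes N: "seminorm N" and "m > 0"
    and x: "m / 2 * (N (x - y))\<^sup>2 \<le> a" and z: "m / 2 * (N (z - y))\<^sup>2 \<le> b"
  shows "(N (x - z))\<^sup>2 \<le> 4 / m * (a + b)"
proof -
  have nn: "N v \<ge> 0" for v
    using N by (simp add: seminorm_def)
  have "N (x - z) \<le> N (x - y) + N (z - y)"
  proof -
    have "N ((x - y) + (y - z)) \<le> N (x - y) + N (y - z)"
      using N unfolding seminorm_def by blast
    then show ?thesis
      by (simp add: seminorm_minus_commute[OF N, of y z])
  qed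
  then have "(N (x - z))\<^sup>2 \<le> (N (x - y) + N (z - y))\<^sup>2"
    by (intro power_mono nn)
  also have "\<dots> \<le> 2 * ((N (x - y))\<^sup>2 + (N (z - y))\<^sup>2)"
    using sum_squares_bound[of "N (x - y)" "N (z - y)"] by (simp add: power2_sum)
  also have "\<dots> = 4 / m * (m / 2 * (N (x - y))\<^sup>2 + m / 2 * (N (z - y))\<^sup>2)"
    using \<open>m > 0\<close> by (simp add: field_simps)
  also have "\<dots> \<le> 4 / m * (a + b)"
    using \<open>m > 0\<close> x z by (intro mult_left_mono) auto
  finally show ?thesis .
qed

section \<open>The framework with real-valued distances\<close>

locale NE_HPE_run =
  fixes w :: "'a::real_inner \<Rightarrow> ereal" and Z :: "'a set" and N :: "'a \<Rightarrow> real"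
    and T :: "'a \<Rightarrow> 'a set" and m M \<sigma> :: real
    and zt z r :: "nat \<Rightarrow> 'a" and \<epsilon> lam \<eta> :: "nat \<Rightarrow> real"
  assumes N: "seminorm N"
    and dg: "distance_generating w" and reg: "regular_wrt w m M Z N"
    and DomT: "op_Dom T \<subseteq> Z" and zeros: "op_inverse T 0 \<noteq> {}"
    and run: "NE_HPE w Z T \<sigma> zt z r \<epsilon> lam \<eta>" and sigma_less: "\<sigma> < 1"
begin

text \<open>Real values can be subtracted and telescoped. On \<open>Z\<close> nothing is lost,
  because the distance is finite there (\<open>bregman_eq_D\<close>).\<close>

definition D :: "'a \<Rightarrow> 'a \<Rightarrow> real" where
  "D a b = real_of_ereal (bregman w a b)"

definition S :: "nat \<Rightarrow> real" where
  "S k = D (z (k - 1)) (zt k) + D (z k) (zt k) + lam k * \<epsilon> k"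

definition C :: real where
  "C = ((1 + \<sigma>) * real_of_ereal (bregman_dist0 w (z 0) T) + 2 * \<eta> 0) / (1 - \<sigma>)"

lemma m_pos: "m > 0" and M_pos: "M > 0"
  using reg by (simp_all add: regular_wrt_def)

lemma Z_interior: "Z \<subseteq> interior (effective_domain w)"
  using reg by (simp add: regular_wrt_def)

lemma Z_domain: "a \<in> Z \<Longrightarrow> a \<in> effective_domain w"
  using Z_interior interior_subset by blast

lemma proper: "proper_fun w"
  using dg by (simp add: distance_generating_def)

lemma sigma_nonneg: "\<sigma> \<ge> 0"
  using run by (simp add: NE_HPE_def)

lemma eta_nonneg: "\<eta> k \<ge> 0"
  using run by (cases "k = 0") (auto simp: NE_HPE_def)

lemma z_in: "z k \<in> Z"
  using run by (cases "k = 0") (auto simp: NE_HPE_def)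

lemma bregman_eq_D: "a \<in> Z \<Longrightarrow> b \<in> Z \<Longrightarrow> bregman w a b = ereal (D a b)"
  unfolding D_def using bregman_finite[OF proper Z_domain Z_domain] by (simp add: ereal_real)

lemma D_ge:
  assumes "a \<in> Z" "b \<in> Z"
  shows "m / 2 * (N (a - b))\<^sup>2 \<le> D a b"
proof -
  have "ereal (m / 2 * (N (a - b))\<^sup>2) \<le> bregman w a b"
    using reg assms unfolding regular_wrt_def by blast
  then show ?thesis
    using bregman_eq_D[OF assms] by simp
qed

lemma D_nonneg:
  assumes "a \<in> Z" "b \<in> Z"
  shows "D a b \<ge> 0"
  using D_ge[OF assms] m_pos by (smt (verit) divide_nonneg_pos mult_nonneg_nonneg zero_le_power2)

lemma dist0_nonneg: "real_of_ereal (bregman_dist0 w (z 0) T) \<ge> 0"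
  using bregman_dist0_finite(2)[OF dg reg DomT zeros z_in] by (rule real_of_ereal_pos)

lemma C_nonneg: "C \<ge> 0"
  unfolding C_def using dist0_nonneg sigma_nonneg sigma_less eta_nonneg[of 0] by simp

section \<open>Estimates for a single iteration\<close>

context
  fixes k :: nat
  assumes k: "k \<ge> 1"
begin

lemma lam_pos: "lam k > 0" and zt_in: "zt k \<in> Z" and eps_nonneg: "\<epsilon> k \<ge> 0"
  and r_enlargement: "r k \<in> enlargement T (\<epsilon> k) (zt k)"
  using run k by (auto simp: NE_HPE_def)

lemma scaled_residual: "lam k *\<^sub>R r k = grad w (z (k - 1)) - grad w (z k)"
proof -
  have "r k = (1 / lam k) *\<^sub>R grad (bregman w (z k)) (z (k - 1))"
    using run k by (simp add: NE_HPE_def)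
  also have "grad (bregman w (z k)) (z (k - 1)) = grad w (z (k - 1)) - grad w (z k)"
    using z_in Z_interior by (intro grad_bregman dg) auto
  finally show ?thesis
    using lam_pos by simp
qed

lemma error_criterion:
  "D (z k) (zt k) + lam k * \<epsilon> k + \<eta> k \<le> \<sigma> * D (z (k - 1)) (zt k) + \<eta> (k - 1)"
proof -
  have "bregman w (z k) (zt k) + ereal (lam k * \<epsilon> k + \<eta> k)
      \<le> ereal \<sigma> * bregman w (z (k - 1)) (zt k) + ereal (\<eta> (k - 1))"
    using run k by (simp add: NE_HPE_def)
  then show ?thesis
    by (simp add: bregman_eq_D z_in zt_in)
qed

lemma bregman_decrease:
  assumes x: "x \<in> op_inverse T 0"
  shows "(1 - \<sigma>) * D (z (k - 1)) (zt k) + D (z k) x + \<eta> k \<le> D (z (k - 1)) x + \<eta> (k - 1)"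
proof -
  have xZ: "x \<in> Z"
    using x DomT by (auto simp: op_inverse_def op_Dom_def)
  \<comment> \<open>Since \<open>0 \<in> T x\<close>, the pair \<open>(x, 0)\<close> can be tested
    in the definition of the enlargement.\<close>
  have "(r k - 0) \<bullet> (zt k - x) \<ge> - \<epsilon> k"
    using r_enlargement x unfolding enlargement_def op_inverse_def by blast
  then have "lam k * (r k \<bullet> (zt k - x)) \<ge> lam k * (- \<epsilon> k)"
    using lam_pos by (intro mult_left_mono) auto
  then have "(grad w (z (k - 1)) - grad w (z k)) \<bullet> (zt k - x) \<ge> - (lam k * \<epsilon> k)"
    unfolding scaled_residual[symmetric] by simp
  \<comment> \<open>Each difference of distances loses the value of \<open>w\<close> at its common
    second argument; the values at the two iterates cancel between the sides, so only gradients
    remain.\<close>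
  moreover have "D (z (k - 1)) x - D (z k) x = D (z (k - 1)) (zt k) - D (z k) (zt k)
      + (grad w (z (k - 1)) - grad w (z k)) \<bullet> (zt k - x)"
    by (simp add: D_def real_of_bregman proper Z_domain z_in zt_in xZ algebra_simps)
  ultimately show ?thesis
    using error_criterion by (simp add: algebra_simps)
qed

lemma S_le: "S k \<le> (1 + \<sigma>) * D (z (k - 1)) (zt k) + \<eta> (k - 1) - \<eta> k"
  using error_criterion by (simp add: S_def algebra_simps)

lemma eps_le: "lam k * \<epsilon> k \<le> S k"
  unfolding S_def using D_nonneg z_in zt_in by simp

text \<open>Regularity bounds the dual seminorm of the gradient difference
  \<open>lam k *\<^sub>R r k\<close> by \<open>M\<close> times the distance of consecutive iterates.
  As \<open>S k\<close> measures the iterates only against \<open>zt k\<close>, that distance is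
  routed through \<open>zt k\<close>.\<close>

lemma residual_le: "dual_seminorm N (r k) \<le> ereal (2 * M / sqrt m * sqrt (S k / (lam k)\<^sup>2))"
proof -
  let ?n = "N (z (k - 1) - z k)"
  have "?n\<^sup>2 \<le> 4 / m * (D (z (k - 1)) (zt k) + D (z k) (zt k))"
    by (rule seminorm_dist_sq_le[OF N m_pos D_ge[OF z_in zt_in] D_ge[OF z_in zt_in]])
  also have "\<dots> \<le> 4 / m * S k"
    unfolding S_def using m_pos lam_pos eps_nonneg by (intro mult_left_mono) auto
  finally have "?n \<le> sqrt (4 / m * S k)"
    by (rule real_le_rsqrt)
  also have "\<dots> = 2 / sqrt m * sqrt (S k)"
    by (simp add: real_sqrt_mult real_sqrt_divide)
  finally have n: "M * ?n \<le> M * (2 / sqrt m * sqrt (S k))"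
    using M_pos by (intro mult_left_mono) auto
  have "dual_seminorm N (lam k *\<^sub>R r k) \<le> ereal (M * ?n)"
    unfolding scaled_residual using reg z_in unfolding regular_wrt_def by blast
  also have "\<dots> \<le> ereal (M * (2 / sqrt m * sqrt (S k)))"
    using n by simp
  finally have "dual_seminorm N (r k) \<le> ereal (M * (2 / sqrt m * sqrt (S k)) / lam k)"
    by (rule dual_seminorm_scaleR_le[OF lam_pos])
  also have "M * (2 / sqrt m * sqrt (S k)) / lam k = 2 * M / sqrt m * sqrt (S k / (lam k)\<^sup>2)"
    using lam_pos by (simp add: real_sqrt_divide)
  finally show ?thesis .
qed

end

section \<open>Summation over the iterations\<close>

lemma sum_D_le_zero:
  assumes x: "x \<in> op_inverse T 0"
  shows "(1 - \<sigma>) * (\<Sum>j=1..k. D (z (j - 1)) (zt j)) + D (z k) x + \<eta> k \<le> D (z 0) x + \<eta> 0"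
proof (induction k)
  case (Suc k)
  then show ?case
    using bregman_decrease[OF _ x, of "Suc k"] by (simp add: distrib_left)
qed simp

lemma sum_D_le:
  "(1 - \<sigma>) * (\<Sum>j=1..k. D (z (j - 1)) (zt j)) \<le> real_of_ereal (bregman_dist0 w (z 0) T) + \<eta> 0"
    (is "?s \<le> _")
proof -
  \<comment> \<open>The left side is independent of the zero \<open>x\<close>, so it is a lower
    bound for the infimum, whether or not that is attained.\<close>
  have "ereal (?s - \<eta> 0) \<le> bregman_dist0 w (z 0) T"
    unfolding bregman_dist0_def
  proof (rule INF_greatest)
    fix x assume x: "x \<in> op_inverse T 0"
    then have xZ: "x \<in> Z"
      using DomT by (auto simp: op_inverse_def op_Dom_def)
    show "ereal (?s - \<eta> 0) \<le> bregman w (z 0) x"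
      using sum_D_le_zero[OF x, of k] D_nonneg[OF z_in xZ, of k] eta_nonneg[of k]
      by (simp add: bregman_eq_D z_in xZ)
  qed
  \<comment> \<open>Finiteness of the infimum excludes the default value 0 of
    \<open>real_of_ereal\<close> at infinity.\<close>
  also have "\<dots> = ereal (real_of_ereal (bregman_dist0 w (z 0) T))"
    using bregman_dist0_finite(1)[OF dg reg DomT zeros z_in] by (simp add: ereal_real)
  finally show ?thesis by simp
qed

lemma sum_S_le: "(\<Sum>j=1..k. S j) \<le> C"
proof -
  let ?A = "\<Sum>j=1..k. D (z (j - 1)) (zt j)"
  let ?d = "real_of_ereal (bregman_dist0 w (z 0) T)"
  have "(\<Sum>j=1..k. S j) \<le> (1 + \<sigma>) * ?A + \<eta> 0 - \<eta> k"
  proof (induction k)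
    case (Suc k)
    then show ?case
      using S_le[of "Suc k"] by (simp add: distrib_left)
  qed simp
  also have "\<dots> \<le> (1 + \<sigma>) * ?A + \<eta> 0"
    using eta_nonneg by simp
  also have "\<dots> \<le> (1 + \<sigma>) * ((?d + \<eta> 0) / (1 - \<sigma>)) + \<eta> 0"
    using sum_D_le[of k] sigma_less sigma_nonneg
    by (intro add_right_mono mult_left_mono) (simp_all add: field_simps)
  \<comment> \<open>The coefficient of \<open>\<eta> 0\<close> is
    \<open>(1 + \<sigma>) / (1 - \<sigma>) + 1 = 2 / (1 - \<sigma>)\<close>.\<close>
  also have "\<dots> = C"
    using sigma_less by (simp add: C_def field_simps)
  finally show ?thesis .
qed

section \<open>Selecting a good index\<close>

text \<open>Common source of (a) and (b), with the weights \<open>c\<close> left free. One index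
  serves both bounds because both quantities are controlled by the same \<open>S i\<close>.\<close>

lemma exists_bounds:
  assumes k: "k \<ge> 1" and c: "\<And>j. j \<ge> 1 \<Longrightarrow> c j > 0"
  shows "\<exists>i\<in>{1..k}.
    dual_seminorm N (r i)
      \<le> ereal (2 * M / sqrt m * sqrt (c i * (C / (\<Sum>j=1..k. c j)) / (lam i)\<^sup>2)) \<and>
    \<epsilon> i \<le> c i * (C / (\<Sum>j=1..k. c j)) / lam i"
proof -
  obtain i where i: "i \<in> {1..k}" and le: "S i \<le> c i * (C / (\<Sum>j=1..k. c j))"
    using exists_le_weighted_average[of "{1..k}" c S C] k c sum_S_le[of k] by auto
  have i1: "i \<ge> 1" using i by simp
  note residual_le[OF i1]
  also have "ereal (2 * M / sqrt m * sqrt (S i / (lam i)\<^sup>2))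
      \<le> ereal (2 * M / sqrt m * sqrt (c i * (C / (\<Sum>j=1..k. c j)) / (lam i)\<^sup>2))"
    unfolding ereal_less_eq using le M_pos m_pos
    by (intro mult_left_mono real_sqrt_le_mono divide_right_mono) auto
  finally have "dual_seminorm N (r i)
      \<le> ereal (2 * M / sqrt m * sqrt (c i * (C / (\<Sum>j=1..k. c j)) / (lam i)\<^sup>2))" .
  moreover have "\<epsilon> i \<le> c i * (C / (\<Sum>j=1..k. c j)) / lam i"
    unfolding pos_le_divide_eq[OF lam_pos[OF i1]] using le eps_le[OF i1] by (simp only: mult.commute)
  ultimately show ?thesis
    using i by blast
qed

lemma lmin_le:
  assumes "j \<ge> 1"
  shows "(INF j\<in>{1..}. lam j) \<le> lam j"
proof (rule cINF_lower)
  \<comment> \<open>A real infimum is a lower bound only for sets bounded below; positivity of the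
    stepsizes supplies the bound 0.\<close>
  show "bdd_below (lam ` {1..})"
    using lam_pos by (intro bdd_belowI2[of _ 0]) (auto simp: less_imp_le)
qed (use assms in simp)

lemma bounds_a:
  assumes k: "k \<ge> 1"
  shows "\<exists>i\<in>{1..k}.
    dual_seminorm N (r i)
      \<le> ereal (2 * M / sqrt m * sqrt (C * (inverse (lam i) / (\<Sum>j=1..k. lam j)))) \<and>
    \<epsilon> i \<le> C / (\<Sum>j=1..k. lam j)"
proof -
  obtain i where i: "i \<in> {1..k}"
    and r: "dual_seminorm N (r i)
      \<le> ereal (2 * M / sqrt m * sqrt (lam i * (C / (\<Sum>j=1..k. lam j)) / (lam i)\<^sup>2))"
    and e: "\<epsilon> i \<le> lam i * (C / (\<Sum>j=1..k. lam j)) / lam i"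
    using exists_bounds[OF k, of lam] lam_pos by blast
  have pos: "lam i > 0" using lam_pos i by simp
  have "lam i * (C / (\<Sum>j=1..k. lam j)) / (lam i)\<^sup>2 = C * (inverse (lam i) / (\<Sum>j=1..k. lam j))"
    using pos by (simp add: power2_eq_square divide_inverse)
  with r e pos i show ?thesis by auto
qed

text \<open>The weights \<open>(lam j)\<^sup>2\<close> cancel the \<open>(lam i)\<^sup>2\<close>
  under the root, so the residual bound no longer depends on \<open>i\<close>.\<close>

lemma bounds_b:
  assumes k: "k \<ge> 1"
  shows "\<exists>i\<in>{1..k}.
    dual_seminorm N (r i)
      \<le> ereal (2 * M / sqrt m * sqrt (C * (1 / (\<Sum>j=1..k. (lam j)\<^sup>2)))) \<and>
    \<epsilon> i \<le> C * lam i / (\<Sum>j=1..k. (lam j)\<^sup>2)"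
proof -
  obtain i where i: "i \<in> {1..k}"
    and r: "dual_seminorm N (r i)
      \<le> ereal (2 * M / sqrt m * sqrt ((lam i)\<^sup>2 * (C / (\<Sum>j=1..k. (lam j)\<^sup>2)) / (lam i)\<^sup>2))"
    and e: "\<epsilon> i \<le> (lam i)\<^sup>2 * (C / (\<Sum>j=1..k. (lam j)\<^sup>2)) / lam i"
    using exists_bounds[OF k, of "\<lambda>j. (lam j)\<^sup>2"] lam_pos zero_less_power by blast
  have pos: "lam i > 0" using lam_pos i by simp
  have "(lam i)\<^sup>2 * (C / (\<Sum>j=1..k. (lam j)\<^sup>2)) / lam i = C * lam i / (\<Sum>j=1..k. (lam j)\<^sup>2)"
    using pos by (simp add: power2_eq_square)
  with r e pos i show ?thesis by auto
qed

lemma sum_lam_ge: "real k * (INF j\<in>{1..}. lam j) \<le> (\<Sum>j=1..k. lam j)"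
  using sum_mono[of "{1..k}" "\<lambda>_. INF j\<in>{1..}. lam j" lam] lmin_le by simp

section \<open>Rates in terms of the smallest stepsize\<close>

text \<open>Both \<open>lam i\<close> and the mean of the first \<open>k\<close> stepsizes are at
  least \<open>?l\<close>, so the radicand is at most
  \<open>C / (real k * ?l\<^sup>2)\<close>.\<close>

lemma uniform_residual_bound:
  assumes k: "k \<ge> 1" and i: "i \<ge> 1" and l: "(INF j\<in>{1..}. lam j) > 0" (is "?l > 0")
  shows "2 * M / sqrt m * sqrt (C * (inverse (lam i) / (\<Sum>j=1..k. lam j)))
    \<le> 2 * M / (?l * sqrt (m * real k)) * sqrt C"
proof -
  have "inverse (lam i) / (\<Sum>j=1..k. lam j) \<le> inverse ?l / (real k * ?l)"
    using k l lmin_le[OF i] lam_pos[OF i] sum_lam_ge[of k]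
    by (intro frac_le le_imp_inverse_le) auto
  then have "sqrt (C * (inverse (lam i) / (\<Sum>j=1..k. lam j))) \<le> sqrt (C * (inverse ?l / (real k * ?l)))"
    by (intro real_sqrt_le_mono mult_left_mono C_nonneg)
  also have "C * (inverse ?l / (real k * ?l)) = C / (real k * ?l\<^sup>2)"
    using l by (simp add: field_simps power2_eq_square)
  also have "sqrt (C / (real k * ?l\<^sup>2)) = sqrt C / (sqrt (real k) * ?l)"
    using l by (simp add: real_sqrt_divide real_sqrt_mult)
  finally have "2 * M / sqrt m * sqrt (C * (inverse (lam i) / (\<Sum>j=1..k. lam j)))
      \<le> 2 * M / sqrt m * (sqrt C / (sqrt (real k) * ?l))"
    using M_pos m_pos by (intro mult_left_mono) auto
  then show ?thesis
    by (simp add: real_sqrt_mult mult_ac)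
qed

lemma uniform_eps_bound:
  assumes k: "k \<ge> 1" and l: "(INF j\<in>{1..}. lam j) > 0" (is "?l > 0")
  shows "C / (\<Sum>j=1..k. lam j) \<le> C / (?l * real k)"
proof (rule divide_left_mono)
  show "?l * real k \<le> (\<Sum>j=1..k. lam j)"
    using sum_lam_ge by (simp add: mult.commute)
  moreover have "?l * real k > 0"
    using k l by simp
  ultimately show "(\<Sum>j=1..k. lam j) * (?l * real k) > 0"
    by (meson less_le_trans mult_pos_pos)
qed (rule C_nonneg)

end

theorem theorem3p3:
  fixes w :: "'a::real_inner \<Rightarrow> ereal" and Z :: "'a set" and N :: "'a \<Rightarrow> real"
    and T :: "'a \<Rightarrow> 'a set" and m M \<sigma> :: real
    and zt z r :: "nat \<Rightarrow> 'a" and \<epsilon> lam \<eta> :: "nat \<Rightarrow> real"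
  assumes fin_dim: "\<exists>B::'a set. finite B \<and> span B = UNIV"
    and "closed Z" and "convex Z" and "Z \<subseteq> interior (effective_domain w)"
    and "seminorm N"
    and "m > 0" and "M > 0"
    and "distance_generating w" and "regular_wrt w m M Z N"
    and "maximal_monotone T" and "op_Dom T \<subseteq> Z" and "op_inverse T 0 \<noteq> {}"
    and "NE_HPE w Z T \<sigma> zt z r \<epsilon> lam \<eta>" and "\<sigma> < 1"
  shows "let d0 = real_of_ereal (bregman_dist0 w (z 0) T); lmin = (INF j\<in>{1..}. lam j) in
    \<forall>k\<ge>1. r k \<in> enlargement T (\<epsilon> k) (zt k) \<and>
      (lmin > 0 \<longrightarrow> (\<exists>i\<in>{1..k}.
         dual_seminorm N (r i)
           \<le> ereal (2 * M / sqrt m * sqrt (((1 + \<sigma>) * d0 + 2 * \<eta> 0) / (1 - \<sigma>)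
                      * (inverse (lam i) / (\<Sum>j=1..k. lam j)))) \<and>
         2 * M / sqrt m * sqrt (((1 + \<sigma>) * d0 + 2 * \<eta> 0) / (1 - \<sigma>)
                      * (inverse (lam i) / (\<Sum>j=1..k. lam j)))
           \<le> 2 * M / (lmin * sqrt (m * real k)) * sqrt (((1 + \<sigma>) * d0 + 2 * \<eta> 0) / (1 - \<sigma>)) \<and>
         \<epsilon> i \<le> ((1 + \<sigma>) * d0 + 2 * \<eta> 0) / ((1 - \<sigma>) * (\<Sum>j=1..k. lam j)) \<and>
         ((1 + \<sigma>) * d0 + 2 * \<eta> 0) / ((1 - \<sigma>) * (\<Sum>j=1..k. lam j))
           \<le> ((1 + \<sigma>) * d0 + 2 * \<eta> 0) / ((1 - \<sigma>) * lmin * real k))) \<and>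
      (\<exists>i\<in>{1..k}.
         dual_seminorm N (r i)
           \<le> ereal (2 * M / sqrt m * sqrt (((1 + \<sigma>) * d0 + 2 * \<eta> 0) / (1 - \<sigma>)
                      * (1 / (\<Sum>j=1..k. (lam j)\<^sup>2)))) \<and>
         \<epsilon> i \<le> (((1 + \<sigma>) * d0 + 2 * \<eta> 0) * lam i) / ((1 - \<sigma>) * (\<Sum>j=1..k. (lam j)\<^sup>2)))"
proof -
  interpret NE_HPE_run w Z N T m M \<sigma> zt z r \<epsilon> lam \<eta>
    by unfold_locales (use assms in auto)
  let ?d = "real_of_ereal (bregman_dist0 w (z 0) T)"
  let ?l = "INF j\<in>{1..}. lam j"
  have C: "((1 + \<sigma>) * ?d + 2 * \<eta> 0) / (1 - \<sigma>) = C"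
    by (simp add: C_def)
  have C_div: "((1 + \<sigma>) * ?d + 2 * \<eta> 0) / ((1 - \<sigma>) * x) = C / x" for x
    by (simp add: C_def)
  \<comment> \<open>Products associate to the left, so \<open>C_div\<close> does not match this
    denominator.\<close>
  have C_div_l: "((1 + \<sigma>) * ?d + 2 * \<eta> 0) / ((1 - \<sigma>) * ?l * x) = C / (?l * x)" for x
    by (simp add: C_def)
  have C_mult_div: "((1 + \<sigma>) * ?d + 2 * \<eta> 0) * y / ((1 - \<sigma>) * x) = C * y / x" for x y
    by (simp add: C_def)
  show ?thesis
    unfolding Let_def C C_div C_div_l C_mult_div
  proof (intro allI impI conjI)
    fix k :: nat assume k: "k \<ge> 1"
    show "r k \<in> enlargement T (\<epsilon> k) (zt k)"
      using r_enlargement[OF k] .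
    show "\<exists>i\<in>{1..k}.
        dual_seminorm N (r i)
          \<le> ereal (2 * M / sqrt m * sqrt (C * (inverse (lam i) / (\<Sum>j=1..k. lam j)))) \<and>
        2 * M / sqrt m * sqrt (C * (inverse (lam i) / (\<Sum>j=1..k. lam j)))
          \<le> 2 * M / (?l * sqrt (m * real k)) * sqrt C \<and>
        \<epsilon> i \<le> C / (\<Sum>j=1..k. lam j) \<and>
        C / (\<Sum>j=1..k. lam j) \<le> C / (?l * real k)"
      if l: "?l > 0"
      \<comment> \<open>The second inequality of each chain holds for every index, so the index from
        \<open>bounds_a\<close> can be kept.\<close>
      using bounds_a[OF k] uniform_residual_bound[OF k _ l] uniform_eps_bound[OF k l]
      by (meson atLeastAtMost_iff)
    show "\<exists>i\<in>{1..k}.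
        dual_seminorm N (r i)
          \<le> ereal (2 * M / sqrt m * sqrt (C * (1 / (\<Sum>j=1..k. (lam j)\<^sup>2)))) \<and>
        \<epsilon> i \<le> C * lam i / (\<Sum>j=1..k. (lam j)\<^sup>2)"
      by (rule bounds_b[OF k])
  qed
qed

end
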